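(* Let $F(t,x,\dot x)=0$ be a differential-algebraic equation with $F\colon\mathbb I\times\mathbb D_x\times\mathbb D_{\dot x}\to\mathbb R^n$, $\mathbb I\subseteq\mathbb R$ an interval, $\mathbb D_x,\mathbb D_{\dot x}\subseteq\mathbb R^n$ open. Let $\Theta\subseteq\{x_1,\dots,x_n,\dot x_1,\dots,\dot x_n\}$ be the set of variables that appear in $F$, and let $$R_{\mathrm{equal}}=\{(\theta,\tilde\theta)\in\Theta\times\Theta \mid \exists\, \xi\in\{x_1,\dots,x_n\},\ p,q\in\mathbb N_0 \text{ with } \theta=\xi^{(p)},\ \tilde\theta=\xi^{(q)}\}.$$ Then the Pantelides algorithm (described in the context) applied to the DAE $F(t,x,\dot x)=0$ terminates if and only if the DAE is structurally nonsingular with respect to $\Theta/R_{\mathrm{equal}}$.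
   Context: Structural conventions. Only the information which variable appears in which scalar equation is used; variables are treated as formal symbols $x_i^{(k)}$ ($k$ is the order of differentiation, $x_i^{(0)}=x_i$, $x_i^{(1)}=\dot x_i$), equations as formal symbols $F_j^{(\ell)}$. If an equation $E$ is replaced by its total time derivative $\dot E$, then (chain rule) the variables appearing in $\dot E$ are by convention exactly the variables $x_i^{(k)}$ appearing in $E$ together with all $x_i^{(k+1)}$ for which $x_i^{(k)}$ appears in $E$. Structural singularity. Given a system of equations, a set $\Theta$ of variables and an equivalence relation $R$ on $\Theta$, a subset of $m$ of the equations is structurally singular if $m$ is strictly larger than the number of equivalence classes of $R$ restricted to the set of those elements of $\Theta$ that appear in at least one of these $m$ equations. The system is structurally singular with respect to $\Theta/R$ if it contains a structurally singular subset of equations, and structurally nonsingular otherwise. Matchings. A matching in a bipartite graph (equations versus variables) is a set of edges no two of which share a vertex; a vertex in no matching edge is exposed. An alternating path is a path (with distinct vertices) that starts with a non-matching edge and in which non-matching and matching edges alternate. An augmenting path starting in an exposed equation is an alternating path whose last edge is non-matching and which ends in an exposed variable. The Pantelides algorithm. Start with the current equations $F_1,\dots,F_n$, the set $V=\Theta$ of present variables, and the empty matching. For $r=1,\dots,n$ do the following. Repeat: (1) Let $\tilde V$ be the set of $x_i^{(k)}\in V$ such that $x_i^{(k+s)}\notin V$ for all $s>0$ (the highest derivatives), and consider the bipartite graph between the current equations and $\tilde V$, with an edge whenever the variable appears in the equation. (2) Search (depth first) for an augmenting path, with respect to the current matching, starting in the current $r$-th equation. (3) If one is found, augment the matching along it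 (so that the $r$-th equation becomes matched), leave the repeat-loop and continue with $r+1$. (4) Otherwise let $C$ be the set consisting of the current $r$-th equation and all equations reachable from it by an alternating path, and $W\subseteq\tilde V$ the set of variables adjacent to an equation in $C$. Replace every equation in $C$ by its total derivative, replace $V$ by $V\cup\{x_i^{(k+1)}\mid x_i^{(k)}\in W\}$, replace every matching edge between $x_i^{(k)}\in W$ and an equation $E\in C$ by the edge between $x_i^{(k+1)}$ and $\dot E$, and repeat with the same $r$. The algorithm terminates if it completes the loop for $r=n$ after finitely many steps. *)

theory Defs
  imports "HOL-Analysis.Analysis"
begin

text \<open>The formal symbol \<open>x\<^sub>i\<^sup>(\<^sup>k\<^sup>)\<close> is the pair \<open>(i, k)\<close>, the formal symbol \<open>F\<^sub>j\<^sup>(\<^sup>l\<^sup>)\<close> is the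
  pair \<open>(j, l)\<close>.\<close>

type_synonym 'n var = "'n \<times> nat"
type_synonym 'n eqn = "'n \<times> nat"

definition total_deriv :: "'n \<times> nat \<Rightarrow> 'n \<times> nat" where
  "total_deriv a = (fst a, Suc (snd a))"


subsection \<open>Structural information of a DAE\<close>

text \<open>Which variables appear in a scalar equation is a property of its expression, which a function
  does not determine. The information is therefore an additional datum \<open>S\<close>, where \<open>S j\<close> is the set
  of variables appearing in \<open>F\<^sub>j\<close>. Every variable on which \<open>F\<^sub>j\<close> actually depends has to appear in
  \<open>F\<^sub>j\<close>; further variables may appear, as \<open>x\<^sub>1\<close> does in \<open>x\<^sub>1 - x\<^sub>1 + x\<^sub>2\<close>.\<close>

definition structure_of_dae ::
  "real set \<Rightarrow> (real^'n) set \<Rightarrow> (real^'n) set \<Rightarrow> (real \<Rightarrow> real^'n \<Rightarrow> real^'n \<Rightarrow> real^'n)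
     \<Rightarrow> ('n::finite \<Rightarrow> 'n var set) \<Rightarrow> bool" where
  "structure_of_dae I Dx Dxdot F S \<longleftrightarrow>
     (\<forall>j. S j \<subseteq> UNIV \<times> {0, 1}) \<and>
     (\<forall>j i. \<forall>t\<in>I. \<forall>x\<in>Dx. \<forall>x'\<in>Dx. \<forall>y\<in>Dxdot.
        (\<forall>k. k \<noteq> i \<longrightarrow> x $ k = x' $ k) \<and> F t x y $ j \<noteq> F t x' y $ j \<longrightarrow> (i, 0) \<in> S j) \<and>
     (\<forall>j i. \<forall>t\<in>I. \<forall>x\<in>Dx. \<forall>y\<in>Dxdot. \<forall>y'\<in>Dxdot.
        (\<forall>k. k \<noteq> i \<longrightarrow> y $ k = y' $ k) \<and> F t x y $ j \<noteq> F t x y' $ j \<longrightarrow> (i, 1) \<in> S j)"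

definition appearing_vars :: "('n \<Rightarrow> 'n var set) \<Rightarrow> 'n var set" where
  "appearing_vars S = (\<Union>j. S j)"

fun vars_of :: "('n \<Rightarrow> 'n var set) \<Rightarrow> 'n eqn \<Rightarrow> 'n var set" where
  "vars_of S (j, 0) = S j"
| "vars_of S (j, Suc l) = vars_of S (j, l) \<union> total_deriv ` vars_of S (j, l)"


subsection \<open>Structural singularity\<close>

definition singular_subset ::
  "('e \<Rightarrow> 'v set) \<Rightarrow> 'v set \<Rightarrow> ('v \<times> 'v) set \<Rightarrow> 'e set \<Rightarrow> bool" where
  "singular_subset app \<Theta> R A \<longleftrightarrow>
     (let T = {\<theta>\<in>\<Theta>. \<exists>e\<in>A. \<theta> \<in> app e}; Q = T // (R \<inter> T \<times> T)
      in finite Q \<and> card A > card Q)"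

definition structurally_singular ::
  "('e::finite \<Rightarrow> 'v set) \<Rightarrow> 'v set \<Rightarrow> ('v \<times> 'v) set \<Rightarrow> bool" where
  "structurally_singular app \<Theta> R \<longleftrightarrow> (\<exists>A. singular_subset app \<Theta> R A)"

abbreviation structurally_nonsingular ::
  "('e::finite \<Rightarrow> 'v set) \<Rightarrow> 'v set \<Rightarrow> ('v \<times> 'v) set \<Rightarrow> bool" where
  "structurally_nonsingular app \<Theta> R \<equiv> \<not> structurally_singular app \<Theta> R"

definition R_equal :: "'n var set \<Rightarrow> ('n var \<times> 'n var) set" where
  "R_equal \<Theta> = {(\<theta>, \<theta>') \<in> \<Theta> \<times> \<Theta>. \<exists>i p q. \<theta> = (i, p) \<and> \<theta>' = (i, q)}"


subsection \<open>Matchings\<close>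

text \<open>Edge sets of bipartite graphs (matchings among them) are sets of pairs (equation, variable);
  vertices are injected into the sum type, equations on the left.\<close>

definition linked :: "('e \<times> 'v) set \<Rightarrow> 'e + 'v \<Rightarrow> 'e + 'v \<Rightarrow> bool" where
  "linked E a b \<longleftrightarrow> (\<exists>(e, v)\<in>E. {a, b} = {Inl e, Inr v})"

definition exposed :: "('e \<times> 'v) set \<Rightarrow> 'e + 'v \<Rightarrow> bool" where
  "exposed M a \<longleftrightarrow> (\<forall>b. \<not> linked M a b)"

text \<open>Edge number \<open>i\<close> of the path joins \<open>p ! i\<close> and \<open>p ! Suc i\<close>, so the first edge has number 0.\<close>

definition alternating_path :: "('e \<times> 'v) set \<Rightarrow> ('e \<times> 'v) set \<Rightarrow> ('e + 'v) list \<Rightarrow> bool" where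
  "alternating_path E M p \<longleftrightarrow> length p \<ge> 2 \<and> distinct p \<and>
     (\<forall>i. Suc i < length p \<longrightarrow>
        linked E (p ! i) (p ! Suc i) \<and> (linked M (p ! i) (p ! Suc i) \<longleftrightarrow> odd i))"

definition augmenting_path_from ::
  "('e \<times> 'v) set \<Rightarrow> ('e \<times> 'v) set \<Rightarrow> 'e \<Rightarrow> ('e + 'v) list \<Rightarrow> bool" where
  "augmenting_path_from E M e p \<longleftrightarrow> alternating_path E M p \<and>
     hd p = Inl e \<and> exposed M (Inl e) \<and>
     \<not> linked M (p ! (length p - 2)) (p ! (length p - 1)) \<and>
     (\<exists>v. last p = Inr v \<and> exposed M (Inr v))"

definition path_edges :: "('e + 'v) list \<Rightarrow> ('e \<times> 'v) set" where
  "path_edges p = {(e, v). \<exists>i. Suc i < length p \<and> {p ! i, p ! Suc i} = {Inl e, Inr v}}"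

definition augment :: "('e \<times> 'v) set \<Rightarrow> ('e + 'v) list \<Rightarrow> ('e \<times> 'v) set" where
  "augment M p = (M - path_edges p) \<union> (path_edges p - M)"


subsection \<open>The Pantelides algorithm\<close>

text \<open>\<open>deriv_order st j\<close> is the number of differentiations of \<open>F\<^sub>j\<close> so far, and \<open>counter st\<close> is the loop
  counter \<open>r\<close>. The enumeration \<open>num\<close> is the numbering \<open>F\<^sub>1, \<dots>, F\<^sub>n\<close> of the scalar equations, which the
  index type does not provide.\<close>

record 'n pstate =
  deriv_order :: "'n \<Rightarrow> nat"
  present :: "'n var set"
  matching :: "('n eqn \<times> 'n var) set"
  counter :: nat

definition initial_state :: "('n \<Rightarrow> 'n var set) \<Rightarrow> 'n pstate" where
  "initial_state S =
     \<lparr>deriv_order = (\<lambda>j. 0), present = appearing_vars S, matching = {}, counter = 1\<rparr>"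

definition current_eqn :: "'n pstate \<Rightarrow> 'n \<Rightarrow> 'n eqn" where
  "current_eqn st j = (j, deriv_order st j)"

definition highest_derivs :: "'n var set \<Rightarrow> 'n var set" where
  "highest_derivs V = {(i, k) \<in> V. \<forall>s>0. (i, k + s) \<notin> V}"

definition graph :: "('n \<Rightarrow> 'n var set) \<Rightarrow> 'n pstate \<Rightarrow> ('n eqn \<times> 'n var) set" where
  "graph S st = {(e, v). e \<in> range (current_eqn st) \<and> v \<in> highest_derivs (present st) \<and>
                         v \<in> vars_of S e}"

definition reachable_eqns :: "('e \<times> 'v) set \<Rightarrow> ('e \<times> 'v) set \<Rightarrow> 'e \<Rightarrow> 'e set" where
  "reachable_eqns E M e =
     {e} \<union> {e'. \<exists>p. alternating_path E M p \<and> hd p = Inl e \<and> last p = Inl e'}"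

definition differentiate ::
  "('n eqn) set \<Rightarrow> 'n var set \<Rightarrow> 'n pstate \<Rightarrow> 'n pstate" where
  "differentiate C W st = st\<lparr>
     deriv_order := (\<lambda>j. if current_eqn st j \<in> C then Suc (deriv_order st j) else deriv_order st j),
     present := present st \<union> total_deriv ` W,
     matching := (\<lambda>(e, v). if e \<in> C \<and> v \<in> W then (total_deriv e, total_deriv v) else (e, v))
                   ` matching st\<rparr>"

text \<open>The outcome of the depth-first search depends on the order in which edges are tried. The
  relation leaves this order open: if there is an augmenting path, the step may use any of them.\<close>

inductive pantelides_step ::
  "('n::finite \<Rightarrow> 'n var set) \<Rightarrow> (nat \<Rightarrow> 'n) \<Rightarrow> 'n pstate \<Rightarrow> 'n pstate \<Rightarrow> bool"
  for S :: "'n \<Rightarrow> 'n var set" and num :: "nat \<Rightarrow> 'n" where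
  found:
    "counter st \<le> CARD('n) \<Longrightarrow> e = current_eqn st (num (counter st)) \<Longrightarrow>
     augmenting_path_from (graph S st) (matching st) e p \<Longrightarrow>
     pantelides_step S num st
       (st\<lparr>matching := augment (matching st) p, counter := Suc (counter st)\<rparr>)"
| not_found:
    "counter st \<le> CARD('n) \<Longrightarrow> e = current_eqn st (num (counter st)) \<Longrightarrow>
     \<nexists>p. augmenting_path_from (graph S st) (matching st) e p \<Longrightarrow>
     C = reachable_eqns (graph S st) (matching st) e \<Longrightarrow>
     W = {v. \<exists>e'\<in>C. (e', v) \<in> graph S st} \<Longrightarrow>
     pantelides_step S num st (differentiate C W st)"

definition finished :: "('n::finite) pstate \<Rightarrow> bool" where
  "finished st \<longleftrightarrow> counter st > CARD('n)"

text \<open>Executions are infinite sequences; a terminated one stays in its final state.\<close>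

definition pantelides_execution ::
  "('n::finite \<Rightarrow> 'n var set) \<Rightarrow> (nat \<Rightarrow> 'n) \<Rightarrow> (nat \<Rightarrow> 'n pstate) \<Rightarrow> bool" where
  "pantelides_execution S num \<sigma> \<longleftrightarrow> \<sigma> 0 = initial_state S \<and>
     (\<forall>k. if finished (\<sigma> k) then \<sigma> (Suc k) = \<sigma> k
          else pantelides_step S num (\<sigma> k) (\<sigma> (Suc k)))"

definition terminates :: "(nat \<Rightarrow> ('n::finite) pstate) \<Rightarrow> bool" where
  "terminates \<sigma> \<longleftrightarrow> (\<exists>k. finished (\<sigma> k))"

lemma pantelides_execution_exists:
  fixes S :: "'n::finite \<Rightarrow> 'n var set"
  shows "\<exists>\<sigma>. pantelides_execution S num \<sigma>"
proof -
  let ?Q = "\<lambda>st st'. if finished st then st' = st else pantelides_step S num st st'"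
  have "\<exists>st'. ?Q st st'" for st
  proof (cases "finished st")
    case False
    then have r: "counter st \<le> CARD('n)"
      by (simp add: finished_def)
    show ?thesis
      using False pantelides_step.found[OF r refl, of S num]
        pantelides_step.not_found[OF r refl _ refl refl, of S num] by meson
  qed simp
  then obtain f where f: "?Q st (f st)" for st
    by metis
  have "pantelides_execution S num (\<lambda>k. (f ^^ k) (initial_state S))"
    using f by (simp add: pantelides_execution_def)
  then show ?thesis by blast
qed

end

theory Submission
  imports Defs
begin

text \<open>By Hall's theorem, structural nonsingularity with respect to \<open>R_equal\<close> means that there is an
  injection \<open>f\<close> from equations to indices \<open>i\<close> such that \<open>F\<^sub>j\<close> contains some derivative of \<open>x\<^bsub>f j\<^esub>\<close>.
  If the algorithm terminates, its final matching is such an injection, because each \<open>x\<^sub>i\<close> has only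
  one highest derivative. Conversely, consider the number of present variables minus the
  total number of differentiations. An unsuccessful search lowers it, since \<open>W\<close> is matched into \<open>C\<close>
  without the exposed \<open>r\<close>-th equation, so that \<open>|W| < |C|\<close>. An injection \<open>f\<close> keeps it nonnegative,
  because the present derivatives of \<open>x\<^bsub>f j\<^esub>\<close> outnumber the differentiations of \<open>F\<^sub>j\<close>. Hence only
  finitely many searches are unsuccessful.\<close>

section \<open>Hall's marriage theorem\<close>

text \<open>Induction on \<open>card J\<close>, following Halmos and Vaughan. If a nonempty proper
  subset \<open>K\<close> is tight, \<open>K\<close> and its complement are matched separately.
  Otherwise each such subset has slack, and any single \<open>j\<close> may be matched
  arbitrarily.\<close>

lemma hall_marriage:
  assumes "finite J" "\<And>j. j \<in> J \<Longrightarrow> finite (A j)"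
    and "\<And>K. K \<subseteq> J \<Longrightarrow> card K \<le> card (\<Union>j\<in>K. A j)"
  shows "\<exists>f. inj_on f J \<and> (\<forall>j\<in>J. f j \<in> A j)"
  using assms
proof (induction "card J" arbitrary: J A rule: less_induct)
  case less
  note fin = less.prems(1,2) and hall = less.prems(3)
  show ?case
  proof (cases "\<exists>K. K \<subset> J \<and> K \<noteq> {} \<and> card K = card (\<Union>j\<in>K. A j)")
    case True
    then obtain K where K: "K \<subset> J" "K \<noteq> {}" "card K = card (\<Union>j\<in>K. A j)" by blast
    define U where "U = (\<Union>j\<in>K. A j)"
    have finK: "finite K" using K fin by (meson finite_subset psubset_imp_subset)
    have finU: "finite U" unfolding U_def using finK fin K by blast
    have "card K < card J" using psubset_card_mono[OF fin(1) K(1)] .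
    then obtain f where f: "inj_on f K" "\<forall>j\<in>K. f j \<in> A j"
      using less.hyps[of K A] finK fin hall K(1) by (metis psubsetD psubset_imp_subset subset_trans)
    have ltD: "card (J - K) < card J"
      using K fin by (intro psubset_card_mono) auto
    \<comment> \<open>Hall's condition survives the removal of \<open>U\<close>: apply the old one
      to \<open>L \<union> K\<close> and cancel \<open>card K = card U\<close>.\<close>
    have "card L \<le> card (\<Union>j\<in>L. A j - U)" if L: "L \<subseteq> J - K" for L
    proof -
      have finL: "finite L" using L fin by (meson finite_Diff finite_subset)
      have "card L + card K = card (L \<union> K)"
        using L finL finK by (subst card_Un_disjoint) auto
      also have "\<dots> \<le> card (\<Union>j\<in>L\<union>K. A j)" using L K by (intro hall) auto
      also have "(\<Union>j\<in>L\<union>K. A j) = (\<Union>j\<in>L. A j - U) \<union> U" by (auto simp: U_def)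
      also have "card \<dots> \<le> card (\<Union>j\<in>L. A j - U) + card U" by (rule card_Un_le)
      finally show ?thesis using K(3) by (simp add: U_def)
    qed
    then obtain g where g: "inj_on g (J - K)" "\<forall>j\<in>J - K. g j \<in> A j - U"
      using less.hyps[OF ltD, of "\<lambda>j. A j - U"] fin by auto
    define h where "h j = (if j \<in> K then f j else g j)" for j
    have "inj_on h J"
    proof -
      have "inj_on h K" "inj_on h (J - K)"
        using f(1) g(1) by (auto simp: inj_on_def h_def)
      moreover have "h ` K \<subseteq> U" "h ` (J - K) \<inter> U = {}"
        using f(2) g(2) by (auto simp: h_def U_def)
      ultimately have "inj_on h (K \<union> (J - K))" unfolding inj_on_Un by blast
      moreover have "K \<union> (J - K) = J" using K(1) by blast
      ultimately show ?thesis by simp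
    qed
    moreover have "\<forall>j\<in>J. h j \<in> A j" using f g by (auto simp: h_def)
    ultimately show ?thesis by blast
  next
    case slack: False
    show ?thesis
    proof (cases "J = {}")
      case False
      then obtain j where j: "j \<in> J" by blast
      have "card {j} \<le> card (\<Union>j\<in>{j}. A j)" using j by (intro hall) auto
      then obtain x where x: "x \<in> A j" by fastforce
      have lt: "card (J - {j}) < card J" using j fin by (meson card_Diff1_less)
      \<comment> \<open>Deleting \<open>x\<close> costs at most one element, which the strict
        inequality for \<open>L\<close> can afford.\<close>
      have "card L \<le> card (\<Union>i\<in>L. A i - {x})" if L: "L \<subseteq> J - {j}" for L
      proof (cases "L = {}")
        case False
        have "L \<subset> J" using L j by blast
        then have "card L < card (\<Union>i\<in>L. A i)"
          using slack False hall[of L] by (simp add: less_le) blast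
        moreover have "(\<Union>i\<in>L. A i - {x}) = (\<Union>i\<in>L. A i) - {x}" by blast
        ultimately show ?thesis
          by (auto simp: card_Diff_singleton_if)
      qed simp
      then obtain g where g: "inj_on g (J - {j})" "\<forall>i\<in>J - {j}. g i \<in> A i - {x}"
        using less.hyps[OF lt, of "\<lambda>i. A i - {x}"] fin by auto
      have "inj_on (g(j := x)) J"
        using g by (auto simp: inj_on_def)
      moreover have "\<forall>i\<in>J. (g(j := x)) i \<in> A i" using g x by auto
      ultimately show ?thesis by blast
    qed simp
  qed
qed

section \<open>Alternating paths\<close>

lemma linked_simps [simp]:
  "linked E (Inl e) (Inr v) \<longleftrightarrow> (e, v) \<in> E"
  "linked E (Inr v) (Inl e) \<longleftrightarrow> (e, v) \<in> E"
  "\<not> linked E (Inl e) (Inl e')"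
  "\<not> linked E (Inr v) (Inr v')"
  by (auto simp: linked_def doubleton_eq_iff)

lemma exposed_simps [simp]:
  "exposed M (Inl e) \<longleftrightarrow> e \<notin> Domain M"
  "exposed M (Inr v) \<longleftrightarrow> v \<notin> Range M"
proof -
  show "exposed M (Inl e) \<longleftrightarrow> e \<notin> Domain M"
    unfolding exposed_def by (metis Domain.simps linked_simps(1,3) sum.exhaust)
  show "exposed M (Inr v) \<longleftrightarrow> v \<notin> Range M"
    unfolding exposed_def by (metis Range.simps linked_simps(2,4) sum.exhaust)
qed

text \<open>Unlike \<^const>\<open>alternating_path\<close> this admits the path of length 0, which makes extension
  arguments uniform.\<close>

definition alternating_from ::
  "('e \<times> 'v) set \<Rightarrow> ('e \<times> 'v) set \<Rightarrow> 'e \<Rightarrow> ('e + 'v) list \<Rightarrow> bool" where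
  "alternating_from E M e p \<longleftrightarrow> p \<noteq> [] \<and> hd p = Inl e \<and> distinct p \<and>
     (\<forall>i. Suc i < length p \<longrightarrow>
        linked E (p ! i) (p ! Suc i) \<and> (linked M (p ! i) (p ! Suc i) \<longleftrightarrow> odd i))"

lemma alternating_path_iff:
  "alternating_path E M p \<and> hd p = Inl e \<longleftrightarrow> alternating_from E M e p \<and> length p \<ge> 2"
  by (auto simp: alternating_path_def alternating_from_def)

lemma reachable_eqns_iff:
  "e' \<in> reachable_eqns E M e \<longleftrightarrow> (\<exists>p. alternating_from E M e p \<and> last p = Inl e')"
proof
  assume "e' \<in> reachable_eqns E M e"
  moreover have "alternating_from E M e [Inl e]" by (simp add: alternating_from_def)
  ultimately show "\<exists>p. alternating_from E M e p \<and> last p = Inl e'"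
    unfolding reachable_eqns_def by (auto simp: alternating_path_iff simp flip: conj_assoc)
next
  assume "\<exists>p. alternating_from E M e p \<and> last p = Inl e'"
  then obtain p where p: "alternating_from E M e p" "last p = Inl e'" by blast
  show "e' \<in> reachable_eqns E M e"
  proof (cases "length p \<ge> 2")
    case True
    then show ?thesis using p alternating_path_iff[of E M p e]
      unfolding reachable_eqns_def by blast
  next
    case False
    then obtain a where "p = [a]"
      using p by (cases p; cases "tl p") (auto simp: alternating_from_def)
    then show ?thesis using p by (simp add: alternating_from_def reachable_eqns_def)
  qed
qed

text \<open>The appended edge has number \<open>length p - 1\<close>, hence must be a matching edge
  exactly when \<open>length p\<close> is even.\<close>

lemma alternating_from_snoc:
  assumes "alternating_from E M e p" "b \<notin> set p" "linked E (last p) b"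
    and "linked M (last p) b \<longleftrightarrow> even (length p)"
  shows "alternating_from E M e (p @ [b])"
proof -
  have "linked E ((p @ [b]) ! i) ((p @ [b]) ! Suc i) \<and>
      (linked M ((p @ [b]) ! i) ((p @ [b]) ! Suc i) \<longleftrightarrow> odd i)" if "Suc i < length (p @ [b])" for i
  proof (cases "Suc i < length p")
    case True
    then show ?thesis using assms(1) by (simp add: alternating_from_def nth_append)
  next
    case False
    then have "length p = Suc i" using that by simp
    moreover from this have "last p = p ! i" by (metis diff_Suc_1 last_conv_nth length_0_conv nat.distinct(1))
    ultimately show ?thesis using assms(3,4) by (simp add: nth_append)
  qed
  then show ?thesis using assms(1,2) unfolding alternating_from_def by simp
qed

lemma alternating_from_take:
  assumes "alternating_from E M e p" "i < length p"
  shows "alternating_from E M e (take (Suc i) p)" "last (take (Suc i) p) = p ! i"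
  using assms by (auto simp: alternating_from_def last_conv_nth)

text \<open>The graph is bipartite and the path starts in an equation, so parity decides between
  equation and variable. Hence even edges lead from equations to variables and odd ones
  back.\<close>

lemma alternating_from_isl:
  assumes "alternating_from E M e p" "i < length p"
  shows "isl (p ! i) \<longleftrightarrow> even i"
  using assms(2)
proof (induction i)
  case 0
  then show ?case using assms(1) by (metis alternating_from_def even_zero hd_conv_nth isl_def)
next
  case (Suc i)
  then have "linked E (p ! i) (p ! Suc i)" using assms(1) by (simp add: alternating_from_def)
  then show ?case using Suc by (cases "p ! i"; cases "p ! Suc i") auto
qed

lemma alternating_from_even_step:
  assumes "alternating_from E M e p" "Suc i < length p" "even i"
  obtains x y where "p ! i = Inl x" "p ! Suc i = Inr y" "(x, y) \<in> E" "(x, y) \<notin> M"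
proof -
  have "linked E (p ! i) (p ! Suc i)" "\<not> linked M (p ! i) (p ! Suc i)" "isl (p ! i)"
    using assms alternating_from_isl[OF assms(1), of i] by (auto simp: alternating_from_def)
  then show ?thesis using that by (cases "p ! i"; cases "p ! Suc i") auto
qed

lemma alternating_from_odd_step:
  assumes "alternating_from E M e p" "Suc i < length p" "odd i"
  obtains x y where "p ! i = Inr y" "p ! Suc i = Inl x" "(x, y) \<in> M"
proof -
  have "linked M (p ! i) (p ! Suc i)" "\<not> isl (p ! i)"
    using assms alternating_from_isl[OF assms(1), of i] by (auto simp: alternating_from_def)
  then show ?thesis using that by (cases "p ! i"; cases "p ! Suc i") auto
qed

lemma alternating_from_eqn_cases:
  assumes "alternating_from E M e p" "i < length p" "p ! i = Inl x"
  obtains "i = 0" "x = e" | k y where "i = Suc k" "odd k" "p ! k = Inr y" "(x, y) \<in> M"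
proof (cases i)
  case 0
  then show ?thesis using assms that by (auto simp: alternating_from_def hd_conv_nth)
next
  case (Suc k)
  then have "odd k" using assms alternating_from_isl[OF assms(1,2)] by simp
  then show ?thesis
    using alternating_from_odd_step[OF assms(1), of k] Suc assms that by (metis Inl_inject)
qed

lemma alternating_from_last_eqn:
  assumes "alternating_from E M e p" "last p = Inl x"
  shows "odd (length p)"
proof -
  have "p \<noteq> []" using assms by (simp add: alternating_from_def)
  then show ?thesis using alternating_from_isl[OF assms(1), of "length p - 1"] assms(2)
    by (simp add: last_conv_nth)
qed

text \<open>An exposed \<open>v\<close> next to a reachable equation would extend an alternating
  path to an augmenting one.\<close>

lemma reachable_var_matched:
  assumes none: "\<nexists>p. augmenting_path_from E M e p" and e: "e \<notin> Domain M"
    and e': "e' \<in> reachable_eqns E M e" and v: "(e', v) \<in> E"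
  shows "v \<in> Range M"
proof (rule ccontr)
  assume exp: "v \<notin> Range M"
  obtain p where p: "alternating_from E M e p" "last p = Inl e'"
    using e' by (auto simp: reachable_eqns_iff)
  have odd: "odd (length p)" using alternating_from_last_eqn[OF p] .
  \<comment> \<open>The path ends in an equation, so a variable on it has a successor, joined to it
    by a matching edge.\<close>
  have "Inr v \<notin> set p"
  proof
    assume "Inr v \<in> set p"
    then obtain i where i: "i < length p" "p ! i = Inr v" by (auto simp: in_set_conv_nth)
    then have "odd i" using alternating_from_isl[OF p(1) i(1)] by auto
    moreover from this have "Suc i < length p" using i odd by (metis Suc_lessI even_Suc)
    ultimately show False using alternating_from_odd_step[OF p(1)] i exp
      by (metis Inr_inject Range.intros)
  qed
  then have q: "alternating_from E M e (p @ [Inr v])"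
    using p v exp odd by (intro alternating_from_snoc) auto
  have "augmenting_path_from E M e (p @ [Inr v])"
    using q p e exp alternating_path_iff[of E M "p @ [Inr v]" e] unfolding augmenting_path_from_def
    by (auto simp: nth_append last_conv_nth Suc_le_eq alternating_from_def)
  then show False using none by blast
qed

text \<open>A path to \<open>e'\<close> continues through \<open>v\<close> and the matching edge to
  \<open>e''\<close>. The only obstacle is a repeated vertex: if \<open>e''\<close> is on the path,
  a prefix reaches it, and if \<open>v\<close> is, then its successor is \<open>e''\<close>.\<close>

lemma reachable_eqns_closed:
  assumes M: "single_valued M" "single_valued (M\<inverse>)" "M \<subseteq> E" and e: "e \<notin> Domain M"
    and e': "e' \<in> reachable_eqns E M e" and v: "(e', v) \<in> E" and e'': "(e'', v) \<in> M"
  shows "e'' \<in> reachable_eqns E M e"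
proof (cases "(e', v) \<in> M")
  case True
  then show ?thesis using M(2) e'' e' by (metis converseI single_valuedD)
next
  case False
  obtain p where p: "alternating_from E M e p" "last p = Inl e'"
    using e' by (auto simp: reachable_eqns_iff)
  have odd: "odd (length p)" using alternating_from_last_eqn[OF p] .
  have "\<exists>q. alternating_from E M e q \<and> last q = Inl e''"
  proof (cases "Inl e'' \<in> set p")
    case True
    then obtain i where "i < length p" "p ! i = Inl e''" by (auto simp: in_set_conv_nth)
    then show ?thesis using alternating_from_take[OF p(1)] by metis
  next
    case notin: False
    have v_notin: "Inr v \<notin> set p"
    proof
      assume "Inr v \<in> set p"
      then obtain i where i: "i < length p" "p ! i = Inr v" by (auto simp: in_set_conv_nth)
      then have "odd i" using alternating_from_isl[OF p(1) i(1)] by auto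
      moreover from this have "Suc i < length p" using i odd by (metis Suc_lessI even_Suc)
      ultimately obtain x where "p ! Suc i = Inl x" "(x, v) \<in> M"
        using alternating_from_odd_step[OF p(1), of i] i by (metis Inr_inject)
      then have "Inl e'' \<in> set p"
        using M(2) e'' \<open>Suc i < length p\<close> by (metis converseI nth_mem single_valuedD)
      then show False using notin by blast
    qed
    have q: "alternating_from E M e (p @ [Inr v])"
      using p v v_notin False odd by (intro alternating_from_snoc) auto
    have "alternating_from E M e ((p @ [Inr v]) @ [Inl e''])"
      using notin e'' M(3) odd by (intro alternating_from_snoc[OF q]) auto
    then show ?thesis by fastforce
  qed
  then show ?thesis by (simp add: reachable_eqns_iff)
qed

section \<open>Augmenting a matching along a path\<close>

text \<open>Parity fixes both the direction of an edge and its membership in \<open>M\<close>. The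
  edges that \<open>augment\<close> adds and those that it drops thus become accessible by
  position.\<close>

lemma path_edges_iff:
  assumes p: "alternating_from E M e p"
  shows "(x, y) \<in> path_edges p - M \<longleftrightarrow>
      (\<exists>i. even i \<and> Suc i < length p \<and> p ! i = Inl x \<and> p ! Suc i = Inr y)" (is ?A)
    and "(x, y) \<in> path_edges p \<inter> M \<longleftrightarrow>
      (\<exists>i. odd i \<and> Suc i < length p \<and> p ! i = Inr y \<and> p ! Suc i = Inl x)" (is ?B)
proof -
  have *: "{p ! i, p ! Suc i} = {Inl x, Inr y} \<longleftrightarrow>
      even i \<and> p ! i = Inl x \<and> p ! Suc i = Inr y \<or> odd i \<and> p ! i = Inr y \<and> p ! Suc i = Inl x"
    if "Suc i < length p" for i
    using alternating_from_isl[OF p, of i] that by (auto simp: doubleton_eq_iff)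
  have M: "even i \<Longrightarrow> p ! i = Inl x \<Longrightarrow> p ! Suc i = Inr y \<Longrightarrow> (x, y) \<notin> M"
    "odd i \<Longrightarrow> p ! i = Inr y \<Longrightarrow> p ! Suc i = Inl x \<Longrightarrow> (x, y) \<in> M"
    if "Suc i < length p" for i
    using p that unfolding alternating_from_def by (metis linked_simps(1,2))+
  have P: "(x, y) \<in> path_edges p \<longleftrightarrow> (\<exists>i. Suc i < length p \<and>
      (even i \<and> p ! i = Inl x \<and> p ! Suc i = Inr y \<or> odd i \<and> p ! i = Inr y \<and> p ! Suc i = Inl x))"
    by (simp add: path_edges_def * cong: conj_cong)
  show ?A ?B unfolding Diff_iff Int_iff P using M by blast+
qed

text \<open>Dropped edges cover every vertex of the path except its two exposed ends, so the edges
  kept do not touch the path. Added edges cover all path vertices, once each, so \<open>e\<close> is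
  the only newly matched equation.\<close>

lemma augment_matching:
  assumes aug: "augmenting_path_from E M e p"
    and M: "single_valued M" "single_valued (M\<inverse>)" "M \<subseteq> E"
  shows "single_valued (augment M p)" "single_valued ((augment M p)\<inverse>)" "augment M p \<subseteq> E"
    and "Domain (augment M p) = insert e (Domain M)"
proof -
  let ?P = "path_edges p"
  have p: "alternating_from E M e p" and len: "length p \<ge> 2" and e: "e \<notin> Domain M"
    using aug alternating_path_iff[of E M p e] by (auto simp: augmenting_path_from_def)
  obtain w where w: "last p = Inr w" "w \<notin> Range M"
    using aug by (auto simp: augmenting_path_from_def)
  have dist: "distinct p" using p by (simp add: alternating_from_def)
  have "odd (length p - 1)"
    using alternating_from_isl[OF p, of "length p - 1"] w len last_conv_nth[of p] by fastforce
  then have even: "even (length p)" by (cases "length p") auto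
  note P_diff = path_edges_iff(1)[OF p] and P_int = path_edges_iff(2)[OF p]
  have eqn_edge: "\<exists>y. (x, y) \<in> ?P - M" if x: "Inl x \<in> set p" for x
  proof -
    obtain i where i: "i < length p" "p ! i = Inl x" using x by (auto simp: in_set_conv_nth)
    then have "even i" using alternating_from_isl[OF p i(1)] by auto
    moreover from this have "Suc i < length p" using i even by (metis Suc_lessI even_Suc)
    ultimately show ?thesis using alternating_from_even_step[OF p, of i] i
      unfolding P_diff by metis
  qed
  have on_path: "Inl x \<in> set p" "Inr y \<in> set p" if xy: "(x, y) \<in> ?P" for x y
  proof -
    obtain i where i: "Suc i < length p" "{Inl x, Inr y} = {p ! i, p ! Suc i}"
      using xy by (auto simp: path_edges_def)
    have "{Inl x, Inr y} \<subseteq> set p" unfolding i(2) using i(1) by simp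
    then show "Inl x \<in> set p" "Inr y \<in> set p" by blast+
  qed
  have eqn_matched: "x = e \<or> (\<exists>y. (x, y) \<in> ?P \<inter> M)" if x: "Inl x \<in> set p" for x
  proof -
    obtain i where i: "i < length p" "p ! i = Inl x" using x by (auto simp: in_set_conv_nth)
    show ?thesis using p i
    proof (cases rule: alternating_from_eqn_cases)
      case (2 k y)
      then show ?thesis using i P_int by blast
    qed blast
  qed
  have var_matched: "y = w \<or> (\<exists>x. (x, y) \<in> ?P \<inter> M)" if y: "Inr y \<in> set p" for y
  proof -
    obtain i where i: "i < length p" "p ! i = Inr y" using y by (auto simp: in_set_conv_nth)
    then have odd: "odd i" using alternating_from_isl[OF p i(1)] by auto
    show ?thesis
    proof (cases "Suc i < length p")
      case True
      then show ?thesis using alternating_from_odd_step[OF p True odd] i odd P_int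
        by (metis Inr_inject)
    next
      case False
      then have "last p = p ! i" using i
        by (metis Suc_lessI diff_Suc_1 last_conv_nth length_0_conv less_nat_zero_code)
      then show ?thesis using w i by simp
    qed
  qed
  \<comment> \<open>A matching edge at a vertex of the path lies on the path. Hence no kept edge can
    conflict with an added one.\<close>
  have eqn_P: "(x, y) \<in> ?P" if "Inl x \<in> set p" "(x, y) \<in> M" for x y
    using eqn_matched[OF that(1)] that(2) e M(1) by (metis DomainI IntD1 IntD2 single_valuedD)
  have var_P: "(x, y) \<in> ?P" if "Inr y \<in> set p" "(x, y) \<in> M" for x y
    using var_matched[OF that(1)] that(2) w M(2)
    by (metis IntD1 IntD2 RangeI converseI single_valuedD)
  have P_inj1: "y = y'" if "(x, y) \<in> ?P - M" "(x, y') \<in> ?P - M" for x y y'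
    using that dist unfolding P_diff by (metis Suc_lessD nth_eq_iff_index_eq Inr_inject)
  have P_inj2: "x = x'" if "(x, y) \<in> ?P - M" "(x', y) \<in> ?P - M" for x x' y
    using that dist unfolding P_diff by (metis nat.inject nth_eq_iff_index_eq Inl_inject)
  show "single_valued (augment M p)"
  proof (rule single_valuedI)
    fix x y y' assume "(x, y) \<in> augment M p" "(x, y') \<in> augment M p"
    then show "y = y'" unfolding augment_def
      using P_inj1 eqn_P on_path(1) single_valuedD[OF M(1)] by blast
  qed
  show "single_valued ((augment M p)\<inverse>)"
  proof (rule single_valuedI)
    fix y x x' assume "(y, x) \<in> (augment M p)\<inverse>" "(y, x') \<in> (augment M p)\<inverse>"
    then show "x = x'" unfolding augment_def
      using P_inj2 var_P on_path(2) single_valuedD[OF M(2)] by blast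
  qed
  have "?P - M \<subseteq> E"
  proof
    fix a assume "a \<in> ?P - M"
    then show "a \<in> E" using P_diff[of "fst a" "snd a"] alternating_from_even_step[OF p]
      by (metis Inl_inject Inr_inject prod.collapse)
  qed
  then show "augment M p \<subseteq> E" using M(3) by (auto simp: augment_def)
  have "Inl e \<in> set p" using p by (metis alternating_from_def hd_in_set)
  then show "Domain (augment M p) = insert e (Domain M)"
    unfolding augment_def using eqn_edge eqn_matched on_path(1) by blast
qed

section \<open>The invariant of the algorithm\<close>

lemma vars_of_index: "(i, k) \<in> vars_of S (j, l) \<Longrightarrow> i \<in> fst ` S j"
  by (induction l arbitrary: k) (force simp: total_deriv_def)+

text \<open>One appearing variable thus yields \<open>l + 1\<close> consecutive derivatives in the
  \<open>l\<close>-th derivative of the equation, which later bounds the number of present variables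
  from below.\<close>

lemma vars_of_shift: "(i, k) \<in> S j \<Longrightarrow> m \<le> l \<Longrightarrow> (i, k + m) \<in> vars_of S (j, l)"
proof (induction l arbitrary: m)
  case (Suc l)
  show ?case
  proof (cases "m = Suc l")
    case True
    have "(i, k + l) \<in> vars_of S (j, l)" using Suc by simp
    then show ?thesis using True by (force simp: total_deriv_def)
  qed (use Suc in simp)
qed simp

lemma highest_derivs_unique:
  "(i, k) \<in> highest_derivs V \<Longrightarrow> (i, l) \<in> highest_derivs V \<Longrightarrow> k = l"
  unfolding highest_derivs_def
  by (cases k l rule: linorder_cases) (auto dest: less_imp_add_positive)

text \<open>The third conjunct excludes gaps between the present orders of an \<open>x_i\<close>, so
  that differentiating an equation introduces no variable outside the new set of present ones. The
  domain condition says that exactly the equations numbered below the counter are matched.\<close>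

definition pantelides_inv :: "('n::finite \<Rightarrow> 'n var set) \<Rightarrow> (nat \<Rightarrow> 'n) \<Rightarrow> 'n pstate \<Rightarrow> bool" where
  "pantelides_inv S num st \<longleftrightarrow>
     finite (present st) \<and>
     (\<forall>j. vars_of S (current_eqn st j) \<subseteq> present st) \<and>
     (\<forall>v\<in>present st. v \<in> highest_derivs (present st) \<or> total_deriv v \<in> present st) \<and>
     matching st \<subseteq> graph S st \<and> single_valued (matching st) \<and> single_valued ((matching st)\<inverse>) \<and>
     Domain (matching st) = current_eqn st ` num ` {1..<counter st} \<and> 1 \<le> counter st"

text \<open>Orders 0 and 1 alone leave no room for a gap, and the empty matching fits the counter
  1.\<close>

lemma pantelides_inv_initial:
  assumes S: "\<And>j. S j \<subseteq> UNIV \<times> {0, 1}"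
  shows "pantelides_inv S num (initial_state S)"
proof -
  have V: "appearing_vars S \<subseteq> UNIV \<times> {0, 1}" using S by (auto simp: appearing_vars_def)
  then have "finite (appearing_vars S)" by (rule finite_subset) auto
  moreover have "v \<in> highest_derivs (appearing_vars S) \<or> total_deriv v \<in> appearing_vars S"
    if v: "v \<in> appearing_vars S" for v
  proof (rule disjCI)
    assume n: "total_deriv v \<notin> appearing_vars S"
    obtain i k where ik: "v = (i, k)" by fastforce
    have "(i, k + s) \<notin> appearing_vars S" if "s > 0" for s
      using V n that unfolding ik total_deriv_def by (cases s; cases "s = 1") auto
    then show "v \<in> highest_derivs (appearing_vars S)" using v ik by (auto simp: highest_derivs_def)
  qed
  ultimately show ?thesis
    by (auto simp: pantelides_inv_def initial_state_def current_eqn_def appearing_vars_def)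
qed

lemma pantelides_inv_found:
  assumes inv: "pantelides_inv S num st"
    and e: "e = current_eqn st (num (counter st))"
    and p: "augmenting_path_from (graph S st) (matching st) e p"
  shows "pantelides_inv S num (st\<lparr>matching := augment (matching st) p, counter := Suc (counter st)\<rparr>)"
proof -
  let ?st = "st\<lparr>matching := augment (matching st) p, counter := Suc (counter st)\<rparr>"
  have [simp]: "current_eqn ?st = current_eqn st" "graph S ?st = graph S st"
    by (auto simp: current_eqn_def graph_def fun_eq_iff)
  have "{1..<Suc (counter st)} = insert (counter st) {1..<counter st}"
    using inv by (auto simp: pantelides_inv_def)
  then show ?thesis
    using inv augment_matching[OF p] unfolding pantelides_inv_def by (simp add: e)
qed

section \<open>Effect of an unsuccessful search\<close>

context
  fixes S :: "'n::finite \<Rightarrow> 'n var set" and num :: "nat \<Rightarrow> 'n" and st :: "'n pstate"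
    and e :: "'n eqn" and C :: "'n eqn set" and W :: "'n var set"
  assumes inj: "inj_on num {1..CARD('n)}"
    and inv: "pantelides_inv S num st"
    and counter: "counter st \<le> CARD('n)"
    and e: "e = current_eqn st (num (counter st))"
    and none: "\<nexists>p. augmenting_path_from (graph S st) (matching st) e p"
    and C: "C = reachable_eqns (graph S st) (matching st) e"
    and W: "W = {v. \<exists>e'\<in>C. (e', v) \<in> graph S st}"
begin

lemma inj_current_eqn: "inj (current_eqn st)"
  by (auto simp: inj_def current_eqn_def)

lemma start_exposed: "e \<notin> Domain (matching st)"
proof
  assume "e \<in> Domain (matching st)"
  then obtain k where k: "k \<in> {1..<counter st}" "num (counter st) = num k"
    using inv injD[OF inj_current_eqn] by (auto simp: pantelides_inv_def e)
  then show False using inj_onD[OF inj k(2)] counter by auto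
qed

text \<open>Left to right, the matching edge is an edge of the graph; right to left,
  \<open>C\<close> is closed under passing to matching partners. So a differentiation step shifts
  both ends of a matching edge or neither.\<close>

lemma matched_iff: "(e', v) \<in> matching st \<Longrightarrow> e' \<in> C \<longleftrightarrow> v \<in> W"
  using reachable_eqns_closed[OF _ _ _ start_exposed] inv
  unfolding W C pantelides_inv_def by blast

lemma W_highest: "W \<subseteq> highest_derivs (present st)"
  by (auto simp: W graph_def)

lemma total_deriv_W_notin: "v \<in> W \<Longrightarrow> total_deriv v \<notin> present st"
  using W_highest unfolding highest_derivs_def total_deriv_def
  by (cases v) (auto dest!: subsetD spec[of _ 1])

text \<open>Matching partners inject \<open>W\<close> into \<open>C\<close>. Indices are counted
  instead of elements of \<open>C\<close> because each index in the set adds one to the sum of the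
  derivative orders.\<close>

lemma card_W_less: "card W < card {j. current_eqn st j \<in> C}"
proof -
  let ?J = "{j. current_eqn st j \<in> C}"
  have "\<exists>e'. (e', v) \<in> matching st" if "v \<in> W" for v
    using reachable_var_matched[OF none start_exposed] that unfolding W C by blast
  then obtain g where g: "\<And>v. v \<in> W \<Longrightarrow> (g v, v) \<in> matching st" by metis
  have "inj_on g W"
    using g inv by (metis inj_onI pantelides_inv_def single_valuedD)
  then have "card W = card (g ` W)" by (simp add: card_image)
  also have "g ` W \<subset> current_eqn st ` ?J"
  proof
    show "g ` W \<subseteq> current_eqn st ` ?J"
    proof
      fix a assume "a \<in> g ` W"
      then obtain v where v: "v \<in> W" "a = g v" by blast
      then have "a \<in> C" using g matched_iff by blast
      moreover have "a \<in> range (current_eqn st)"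
        using g[OF v(1)] inv unfolding v(2) pantelides_inv_def graph_def by blast
      ultimately show "a \<in> current_eqn st ` ?J" by auto
    qed
    \<comment> \<open>Strictness: the start \<open>e\<close> is exposed and hence nobody's
      partner.\<close>
    have "e \<in> C" by (simp add: C reachable_eqns_def)
    moreover have "e \<notin> g ` W" using g start_exposed by blast
    ultimately show "g ` W \<noteq> current_eqn st ` ?J" using e by blast
  qed
  then have "card (g ` W) < card (current_eqn st ` ?J)" by (intro psubset_card_mono) auto
  also have "\<dots> = card ?J" using inj_current_eqn by (meson card_image inj_on_subset subset_UNIV)
  finally show ?thesis .
qed

lemma card_present_differentiate: "card (present (differentiate C W st)) = card (present st) + card W"
proof -
  have "finite (present st)" using inv by (simp add: pantelides_inv_def)
  moreover have "finite W" using W_highest calculation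
    by (auto simp: highest_derivs_def intro: finite_subset)
  moreover have "present st \<inter> total_deriv ` W = {}" using total_deriv_W_notin by blast
  moreover have "inj_on total_deriv W" by (auto simp: inj_on_def total_deriv_def)
  ultimately show ?thesis
    by (simp add: differentiate_def card_Un_disjoint card_image)
qed

lemma sum_deriv_order_differentiate:
  "(\<Sum>j\<in>UNIV. deriv_order (differentiate C W st) j) =
     (\<Sum>j\<in>UNIV. deriv_order st j) + card {j. current_eqn st j \<in> C}"
proof -
  have "(\<Sum>j\<in>UNIV. deriv_order (differentiate C W st) j) =
      (\<Sum>j\<in>UNIV. deriv_order st j + (if current_eqn st j \<in> C then 1 else 0))"
    by (intro sum.cong) (auto simp: differentiate_def)
  also have "\<dots> = (\<Sum>j\<in>UNIV. deriv_order st j) + card {j. current_eqn st j \<in> C}"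
    by (simp add: sum.distrib flip: sum.inter_filter)
  finally show ?thesis .
qed

text \<open>At most one derivative per index lies in \<open>W\<close>, namely the highest, so the
  top order of an \<open>x_i\<close> rises by one or stays.\<close>

lemma highest_derivs_differentiate:
  "v \<in> W \<Longrightarrow> total_deriv v \<in> highest_derivs (present (differentiate C W st))"
  "v \<in> highest_derivs (present st) \<Longrightarrow> v \<notin> W \<Longrightarrow>
     v \<in> highest_derivs (present (differentiate C W st))"
proof -
  let ?V = "present st \<union> total_deriv ` W"
  obtain i k where v: "v = (i, k)" by fastforce
  have top: "(i, l) \<in> W \<Longrightarrow> k = l" if "v \<in> highest_derivs (present st)" for l
    using that W_highest highest_derivs_unique[of i k "present st" l] unfolding v by blast
  show "total_deriv v \<in> highest_derivs (present (differentiate C W st))" if "v \<in> W"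
  proof -
    have high: "v \<in> highest_derivs (present st)" using that W_highest by blast
    have "(i, Suc k + s) \<notin> ?V" if "s > 0" for s
    proof -
      have "(i, k + Suc s) \<notin> present st" using high unfolding v highest_derivs_def by blast
      moreover have "(i, Suc k + s) \<notin> total_deriv ` W"
        using top[OF high] that by (auto simp: total_deriv_def)
      ultimately show ?thesis by simp
    qed
    moreover have "(i, Suc k) \<in> ?V" using that by (force simp: v total_deriv_def)
    ultimately show ?thesis
      by (auto simp: highest_derivs_def differentiate_def total_deriv_def v)
  qed
  show "v \<in> highest_derivs (present (differentiate C W st))"
    if high: "v \<in> highest_derivs (present st)" and "v \<notin> W"
  proof -
    have "(i, k + s) \<notin> ?V" if "s > 0" for s
      using top[OF high] that \<open>v \<notin> W\<close> high
      by (auto simp: total_deriv_def v highest_derivs_def)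
    then show ?thesis using high
      by (auto simp: highest_derivs_def differentiate_def v)
  qed
qed

lemma pantelides_inv_not_found: "pantelides_inv S num (differentiate C W st)"
proof -
  let ?st = "differentiate C W st" and ?M = "matching st"
  \<comment> \<open>By \<open>matched_iff\<close>, the joint test in \<open>differentiate\<close>
    separates into one map on equations and one on variables.\<close>
  define dE where "dE a = (if a \<in> C then total_deriv a else a)" for a
  define dV where "dV v = (if v \<in> W then total_deriv v else v)" for v
  have fin: "finite (present st)" and vars: "\<And>j. vars_of S (current_eqn st j) \<subseteq> present st"
    and gap: "\<And>v. v \<in> present st \<Longrightarrow> v \<in> highest_derivs (present st) \<or> total_deriv v \<in> present st"
    and MG: "?M \<subseteq> graph S st" and M: "single_valued ?M" "single_valued (?M\<inverse>)"
    and dom: "Domain ?M = current_eqn st ` num ` {1..<counter st}" and pos: "1 \<le> counter st"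
    using inv by (auto simp: pantelides_inv_def)
  have V: "present ?st = present st \<union> total_deriv ` W" and cnt: "counter ?st = counter st"
    by (simp_all add: differentiate_def)
  have cur: "current_eqn ?st j = dE (current_eqn st j)" for j
    by (simp add: dE_def current_eqn_def differentiate_def total_deriv_def)
  have mat: "matching ?st = (\<lambda>(a, v). (dE a, dV v)) ` ?M"
    unfolding differentiate_def dE_def dV_def using matched_iff
    by (auto intro!: image_cong)
  have fst_d: "fst (dE a) = fst a" "fst (dV v) = fst v" for a v
    by (simp_all add: dE_def dV_def total_deriv_def)
  \<comment> \<open>Both maps preserve the index, and the index alone determines a current equation
    as well as a highest derivative.\<close>
  have dE_inj: "a = b" if "a \<in> Domain ?M" "b \<in> Domain ?M" "dE a = dE b" for a b
  proof -
    have "fst a = fst b" using that(3) fst_d by metis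
    then show ?thesis using that(1,2) dom by (auto simp: current_eqn_def)
  qed
  have dV_inj: "v = w" if "v \<in> Range ?M" "w \<in> Range ?M" "dV v = dV w" for v w
  proof -
    have "fst v = fst w" using that(3) fst_d by metis
    moreover have "v \<in> highest_derivs (present st)" "w \<in> highest_derivs (present st)"
      using that MG by (auto simp: graph_def)
    ultimately show ?thesis using highest_derivs_unique by (metis prod.collapse)
  qed
  have "finite (present ?st)"
    using card_present_differentiate fin W_highest
    by (auto simp: V highest_derivs_def intro!: finite_imageI intro: finite_subset)
  moreover have "vars_of S (current_eqn ?st j) \<subseteq> present ?st" for j
  proof (cases "current_eqn st j \<in> C")
    case True
    let ?A = "vars_of S (current_eqn st j)"
    \<comment> \<open>A highest derivative in an equation of \<open>C\<close> lies in
      \<open>W\<close>, so its derivative has just been added. For any other variable the derivative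
      was present already, as there are no gaps.\<close>
    have "total_deriv v \<in> present ?st" if v: "v \<in> ?A" for v
    proof (cases "v \<in> highest_derivs (present st)")
      case hi: True
      then have "v \<in> W" using v True by (auto simp: W graph_def)
      then show ?thesis by (simp add: V)
    next
      case False
      then show ?thesis using gap vars v V by blast
    qed
    then have "total_deriv ` ?A \<subseteq> present ?st" by blast
    moreover have "?A \<subseteq> present ?st" using vars V by blast
    moreover have "vars_of S (current_eqn ?st j) = ?A \<union> total_deriv ` ?A"
      unfolding cur using True by (simp add: dE_def) (simp add: total_deriv_def current_eqn_def)
    ultimately show ?thesis by simp
  next
    case False
    then show ?thesis using vars by (auto simp: cur dE_def V)
  qed
  moreover have "v \<in> highest_derivs (present ?st) \<or> total_deriv v \<in> present ?st"
    if "v \<in> present ?st" for v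
    using that gap highest_derivs_differentiate unfolding V by blast
  moreover have "matching ?st \<subseteq> graph S ?st"
  proof -
    have "(dE a, dV v) \<in> graph S ?st" if av: "(a, v) \<in> ?M" for a v
    proof -
      have g: "(a, v) \<in> graph S st" using av MG by blast
      then have "dE a \<in> range (current_eqn ?st)" by (auto simp: graph_def cur)
      moreover have "dV v \<in> highest_derivs (present ?st)"
        using g highest_derivs_differentiate by (auto simp: dV_def graph_def)
      moreover have "dV v \<in> vars_of S (dE a)"
        using g matched_iff[OF av] by (cases a) (auto simp: dV_def dE_def graph_def total_deriv_def)
      ultimately show ?thesis by (simp add: graph_def)
    qed
    then show ?thesis by (auto simp: mat)
  qed
  moreover have "single_valued (matching ?st)"
  proof (rule single_valuedI)
    fix x y y' assume "(x, y) \<in> matching ?st" "(x, y') \<in> matching ?st"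
    then obtain a v b w where "(a, v) \<in> ?M" "(b, w) \<in> ?M" "x = dE a" "x = dE b" "y = dV v" "y' = dV w"
      by (auto simp: mat)
    then show "y = y'" using dE_inj[of a b] M(1) by (metis DomainI single_valuedD)
  qed
  moreover have "single_valued ((matching ?st)\<inverse>)"
  proof (rule single_valuedI)
    fix x y y' assume "(x, y) \<in> (matching ?st)\<inverse>" "(x, y') \<in> (matching ?st)\<inverse>"
    then obtain a v b w where "(a, v) \<in> ?M" "(b, w) \<in> ?M" "x = dV v" "x = dV w" "y = dE a" "y' = dE b"
      by (auto simp: mat)
    then show "y = y'" using dV_inj[of v w] M(2) by (metis RangeI converseI single_valuedD)
  qed
  moreover have "Domain (matching ?st) = current_eqn ?st ` num ` {1..<counter ?st}"
  proof -
    have "Domain (matching ?st) = dE ` Domain ?M" by (force simp: mat)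
    then show ?thesis by (simp add: dom cnt cur image_image)
  qed
  ultimately show ?thesis using pos cnt by (simp add: pantelides_inv_def)
qed

end

lemma pantelides_step_inv:
  fixes S :: "'n::finite \<Rightarrow> 'n var set"
  assumes "pantelides_step S num st st'" "inj_on num {1..CARD('n)}" "pantelides_inv S num st"
  shows "pantelides_inv S num st'"
  using assms(1)
proof cases
  case (found e p)
  then show ?thesis using pantelides_inv_found[OF assms(3)] by simp
next
  case (not_found e C W)
  then show ?thesis using pantelides_inv_not_found[OF assms(2,3)] by simp
qed

section \<open>Potential function and its lower bound\<close>

text \<open>Subtracting the counter makes successful searches lower the value too, at the price of
  possibly negative values.\<close>

definition potential :: "('n::finite) pstate \<Rightarrow> int" where
  "potential st = int (card (present st)) - int (\<Sum>j\<in>UNIV. deriv_order st j) - int (counter st)"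

lemma pantelides_step_potential:
  fixes S :: "'n::finite \<Rightarrow> 'n var set"
  assumes "pantelides_step S num st st'" "inj_on num {1..CARD('n)}" "pantelides_inv S num st"
  shows "potential st' < potential st"
  using assms(1)
proof cases
  case (found e p)
  then show ?thesis by (simp add: potential_def)
next
  case (not_found e C W)
  note ctx = assms(2,3) not_found(2-)
  have "counter st' = counter st" by (simp add: not_found(1) differentiate_def)
  then show ?thesis
    using card_W_less[OF ctx] card_present_differentiate[OF ctx] sum_deriv_order_differentiate[OF ctx]
    by (simp add: potential_def not_found(1))
qed

text \<open>Each \<open>F_j\<close> accounts for \<open>deriv_order st j\<close> present derivatives
  of the variable with index \<open>f j\<close>, and injectivity of \<open>f\<close> keeps those of
  different equations apart.\<close>

lemma sum_deriv_order_le_card_present: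
  assumes inv: "pantelides_inv S num st" and f: "inj f" "\<And>j. f j \<in> fst ` S j"
  shows "(\<Sum>j\<in>UNIV. deriv_order st j) \<le> card (present st)"
proof -
  obtain k where k: "\<And>j. (f j, k j) \<in> S j" 
  proof -
    have "\<exists>k. (f j, k) \<in> S j" for j using f(2)[of j] by force
    then show thesis using that by metis
  qed
  define g where "g = (\<lambda>(j, m). (f j, k j + m))"
  let ?X = "SIGMA j:UNIV. {..<deriv_order st j}"
  have "(\<Sum>j\<in>UNIV. deriv_order st j) = card ?X" by simp
  also have "\<dots> = card (g ` ?X)"
    using injD[OF f(1)] by (intro card_image[symmetric]) (force simp: inj_on_def g_def)
  also have "g ` ?X \<subseteq> present st"
  proof -
    have "(f j, k j + m) \<in> present st" if "m < deriv_order st j" for j m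
      using vars_of_shift[of "f j" "k j" S j m "deriv_order st j"] k[of j] that inv
      by (auto simp: pantelides_inv_def current_eqn_def)
    then show ?thesis by (auto simp: g_def)
  qed
  then have "card (g ` ?X) \<le> card (present st)"
    using inv by (intro card_mono) (auto simp: pantelides_inv_def)
  finally show ?thesis .
qed

section \<open>Structural nonsingularity and termination\<close>

text \<open>Within \<open>T\<close>, the class of a variable consists of all elements with the same
  index, so classes correspond to indices.\<close>

lemma card_quotient_R_equal:
  assumes T: "T \<subseteq> \<Theta>" and fin: "finite T"
  shows "finite (T // (R_equal \<Theta> \<inter> T \<times> T))" "card (T // (R_equal \<Theta> \<inter> T \<times> T)) = card (fst ` T)"
proof -
  let ?c = "\<lambda>i. {u \<in> T. fst u = i}"
  have "(R_equal \<Theta> \<inter> T \<times> T) `` {t} = ?c (fst t)" if "t \<in> T" for t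
    using that T by (cases t) (auto simp: R_equal_def)
  then have "T // (R_equal \<Theta> \<inter> T \<times> T) = ?c ` fst ` T"
    by (auto simp: quotient_def image_image)
  moreover have "inj_on ?c (fst ` T)" by (rule inj_onI) blast
  ultimately show "finite (T // (R_equal \<Theta> \<inter> T \<times> T))"
    "card (T // (R_equal \<Theta> \<inter> T \<times> T)) = card (fst ` T)"
    using fin by (simp_all add: card_image)
qed

lemma structurally_nonsingular_R_equal_iff:
  fixes S :: "'n::finite \<Rightarrow> 'n var set"
  assumes fin: "\<And>j. finite (S j)"
  shows "structurally_nonsingular S (appearing_vars S) (R_equal (appearing_vars S)) \<longleftrightarrow>
    (\<exists>f. inj f \<and> (\<forall>j. f j \<in> fst ` S j))"
proof -
  let ?\<Theta> = "appearing_vars S"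
  have "singular_subset S ?\<Theta> (R_equal ?\<Theta>) A \<longleftrightarrow> card (\<Union>j\<in>A. fst ` S j) < card A" for A
  proof -
    have T: "{\<theta>\<in>?\<Theta>. \<exists>e\<in>A. \<theta> \<in> S e} = (\<Union>j\<in>A. S j)" by (auto simp: appearing_vars_def)
    have "(\<Union>j\<in>A. S j) \<subseteq> ?\<Theta>" "finite (\<Union>j\<in>A. S j)" using fin by (auto simp: appearing_vars_def)
    note card_quotient_R_equal[OF this]
    then show ?thesis unfolding singular_subset_def T Let_def by (simp add: image_UN)
  qed
  then have "structurally_nonsingular S ?\<Theta> (R_equal ?\<Theta>) \<longleftrightarrow>
      (\<forall>A. card A \<le> card (\<Union>j\<in>A. fst ` S j))"
    by (simp add: structurally_singular_def not_less)
  also have "\<dots> \<longleftrightarrow> (\<exists>f. inj f \<and> (\<forall>j. f j \<in> fst ` S j))"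
  proof
    assume "\<forall>A. card A \<le> card (\<Union>j\<in>A. fst ` S j)"
    then show "\<exists>f. inj f \<and> (\<forall>j. f j \<in> fst ` S j)"
      using hall_marriage[of UNIV "\<lambda>j. fst ` S j"] fin by auto
  next
    assume "\<exists>f. inj f \<and> (\<forall>j. f j \<in> fst ` S j)"
    then obtain f where f: "inj f" "\<And>j. f j \<in> fst ` S j" by blast
    show "\<forall>A. card A \<le> card (\<Union>j\<in>A. fst ` S j)"
    proof
      fix A
      have "card A = card (f ` A)" using f(1) by (metis card_image inj_on_subset subset_UNIV)
      also have "\<dots> \<le> card (\<Union>j\<in>A. fst ` S j)" using f(2) by (intro card_mono) auto
      finally show "card A \<le> card (\<Union>j\<in>A. fst ` S j)" .
    qed
  qed
  finally show ?thesis .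
qed

lemma finished_imp_injection:
  fixes S :: "'n::finite \<Rightarrow> 'n var set"
  assumes inv: "pantelides_inv S num st" and num: "num ` {1..CARD('n)} = UNIV"
    and fin: "finished st"
  shows "\<exists>f. inj f \<and> (\<forall>j. f j \<in> fst ` S j)"
proof -
  \<comment> \<open>The counter has passed \<open>CARD('n)\<close>, so the numbers below it exhaust
    all equations and every equation is matched.\<close>
  have "num ` {1..CARD('n)} \<subseteq> num ` {1..<counter st}"
    using fin by (intro image_mono) (auto simp: finished_def)
  then have "num ` {1..<counter st} = UNIV" using num by auto
  then have "Domain (matching st) = range (current_eqn st)"
    using inv by (simp add: pantelides_inv_def)
  then have "\<forall>j. \<exists>v. (current_eqn st j, v) \<in> matching st" by blast
  then obtain v where v: "\<And>j. (current_eqn st j, v j) \<in> matching st" by metis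
  then have g: "(current_eqn st j, v j) \<in> graph S st" for j
    using inv by (auto simp: pantelides_inv_def)
  have "inj (\<lambda>j. fst (v j))"
  proof (rule injI)
    fix a b assume "fst (v a) = fst (v b)"
    then have "v a = v b" using g highest_derivs_unique
      by (metis (no_types, lifting) case_prodD graph_def mem_Collect_eq prod.collapse)
    then have "current_eqn st a = current_eqn st b"
      using v inv by (metis converseI pantelides_inv_def single_valuedD)
    then show "a = b" by (simp add: current_eqn_def)
  qed
  \<comment> \<open>Differentiation creates no new indices, so the index of the matched variable
    already occurs in the original \<open>F_j\<close>.\<close>
  moreover have "fst (v j) \<in> fst ` S j" for j
    using g[of j] vars_of_index[of "fst (v j)" "snd (v j)" S j "deriv_order st j"]
    by (simp add: graph_def current_eqn_def)
  ultimately show ?thesis by blast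
qed

theorem theorem2p11:
  fixes F :: "real \<Rightarrow> real^'n \<Rightarrow> real^'n \<Rightarrow> real^'n"
    and I :: "real set" and Dx Dxdot :: "(real^'n) set"
    and S :: "'n::finite \<Rightarrow> 'n var set" and \<Theta> :: "'n var set"
    and num :: "nat \<Rightarrow> 'n" and \<sigma> :: "nat \<Rightarrow> 'n pstate"
  assumes "is_interval I" and "open Dx" and "open Dxdot"
    and "structure_of_dae I Dx Dxdot F S"
    and "\<Theta> = appearing_vars S"
    and "bij_betw num {1..CARD('n)} UNIV"
    and "pantelides_execution S num \<sigma>"
  shows "terminates \<sigma> \<longleftrightarrow> structurally_nonsingular S \<Theta> (R_equal \<Theta>)"
proof -
  have S: "S j \<subseteq> UNIV \<times> {0, 1}" for j using assms(4) by (simp add: structure_of_dae_def)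
  then have finS: "finite (S j)" for j by (rule finite_subset) simp
  have num: "inj_on num {1..CARD('n)}" "num ` {1..CARD('n)} = UNIV"
    using assms(6) by (auto simp: bij_betw_def)
  have step: "if finished (\<sigma> k) then \<sigma> (Suc k) = \<sigma> k else pantelides_step S num (\<sigma> k) (\<sigma> (Suc k))"
    for k using assms(7) by (simp add: pantelides_execution_def)
  have inv: "pantelides_inv S num (\<sigma> k)" for k
  proof (induction k)
    case 0
    then show ?case using assms(7) pantelides_inv_initial[OF S] by (simp add: pantelides_execution_def)
  next
    case (Suc k)
    then show ?case using step[of k] pantelides_step_inv[OF _ num(1)] by (metis (full_types))
  qed
  have "terminates \<sigma> \<longleftrightarrow> (\<exists>f. inj f \<and> (\<forall>j. f j \<in> fst ` S j))"
  proof
    assume "terminates \<sigma>"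
    then show "\<exists>f. inj f \<and> (\<forall>j. f j \<in> fst ` S j)"
      using finished_imp_injection[OF inv num(2)] by (auto simp: terminates_def)
  next
    assume "\<exists>f. inj f \<and> (\<forall>j. f j \<in> fst ` S j)"
    then obtain f where f: "inj f" "\<And>j. f j \<in> fst ` S j" by blast
    show "terminates \<sigma>"
    proof (rule ccontr)
      assume "\<not> terminates \<sigma>"
      then have running: "\<not> finished (\<sigma> k)" for k by (simp add: terminates_def)
      have decr: "potential (\<sigma> k) \<le> potential (\<sigma> 0) - int k" for k
      proof (induction k)
        case (Suc k)
        have "potential (\<sigma> (Suc k)) < potential (\<sigma> k)"
          using step[of k] running[of k] pantelides_step_potential[OF _ num(1) inv] by simp
        then show ?case using Suc by simp
      qed simp
      \<comment> \<open>While the algorithm runs, the counter is at most \<open>CARD('n)\<close>,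
        and the rest of the potential is nonnegative thanks to \<open>f\<close>.\<close>
      have lower: "- int CARD('n) \<le> potential (\<sigma> k)" for k
        using sum_deriv_order_le_card_present[OF inv f, of k] running[of k]
        unfolding potential_def finished_def by linarith
      show False
        \<comment> \<open>One step more than the distance from the initial potential down to the
          lower bound.\<close>
        using decr[of "nat (potential (\<sigma> 0) + int CARD('n)) + 1"]
          lower[of "nat (potential (\<sigma> 0) + int CARD('n)) + 1"] by linarith
    qed
  qed
  then show ?thesis using structurally_nonsingular_R_equal_iff[OF finS] assms(5) by simp
qed

end
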